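(* Let $(X,\mathcal{A})$ be a locally finite measurable space. Then the following three statements are equivalent: (1) $\mathcal{A}$ is a finite $\sigma$-algebra on $X$. (2) $\mathcal{M}_F(X,\mathcal{A})=\mathcal{M}_\infty(X,\mathcal{A})$. (3) $\mathcal{M}_\infty(X,\mathcal{A})$ is an ideal (possibly improper) of $\mathcal{M}(X,\mathcal{A})$.
   Context: A measurable space $(X,\mathcal{A})$ is a nonempty set $X$ with a $\sigma$-algebra $\mathcal{A}$ of subsets of $X$. It is locally finite if for every $x\in X$ there is a finite set $A\in\mathcal{A}$ with $x\in A$. $\mathcal{M}(X,\mathcal{A})$ is the ring (pointwise operations) of all $\mathcal{A}$-measurable functions $f:X\to\mathbb{R}$. $\mathcal{M}_F(X,\mathcal{A})=\{f\in\mathcal{M}(X,\mathcal{A}):\{x\in X: f(x)\neq 0\}\text{ is finite}\}$. $\mathcal{M}_\infty(X,\mathcal{A})=\{f\in\mathcal{M}(X,\mathcal{A}):\text{for all }\epsilon>0,\ \{x\in X:|f(x)|\geq\epsilon\}\text{ is finite}\}$. *)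

theory Defs
  imports "HOL-Analysis.Analysis" "HOL-Algebra.Ideal"
begin

definition measurable_space :: "'a set \<Rightarrow> 'a set set \<Rightarrow> bool" where
  "measurable_space X \<A> \<longleftrightarrow> X \<noteq> {} \<and> sigma_algebra X \<A>"

definition locally_finite_space :: "'a set \<Rightarrow> 'a set set \<Rightarrow> bool" where
  "locally_finite_space X \<A> \<longleftrightarrow>
     measurable_space X \<A> \<and> (\<forall>x\<in>X. \<exists>A\<in>\<A>. finite A \<and> x \<in> A)"

(* Real functions on X are represented by functions on the whole type that are undefined
   outside X, so that HOL equality is equality of functions on X.  For a sigma-algebra \<A>,
   "sigma X \<A>" has space X and measurable sets \<A>; the null measure it carries plays no role. *)
definition meas_funs :: "'a set \<Rightarrow> 'a set set \<Rightarrow> ('a \<Rightarrow> real) set" where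
  "meas_funs X \<A> = borel_measurable (sigma X \<A>) \<inter> extensional X"

definition meas_ring :: "'a set \<Rightarrow> 'a set set \<Rightarrow> ('a \<Rightarrow> real) ring" where
  "meas_ring X \<A> =
     \<lparr>carrier = meas_funs X \<A>,
      monoid.mult = (\<lambda>f g. \<lambda>x\<in>X. f x * g x),
      one = (\<lambda>x\<in>X. 1),
      zero = (\<lambda>x\<in>X. 0),
      add = (\<lambda>f g. \<lambda>x\<in>X. f x + g x)\<rparr>"

definition meas_F :: "'a set \<Rightarrow> 'a set set \<Rightarrow> ('a \<Rightarrow> real) set" where
  "meas_F X \<A> = {f \<in> meas_funs X \<A>. finite {x \<in> X. f x \<noteq> 0}}"

definition meas_inf :: "'a set \<Rightarrow> 'a set set \<Rightarrow> ('a \<Rightarrow> real) set" where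
  "meas_inf X \<A> = {f \<in> meas_funs X \<A>. \<forall>\<epsilon>>0. finite {x \<in> X. \<bar>f x\<bar> \<ge> \<epsilon>}}"

lemma meas_funs_iff:
  assumes "sigma_algebra X \<A>"
  shows "f \<in> meas_funs X \<A> \<longleftrightarrow>
    f \<in> extensional X \<and> (\<forall>B \<in> sets borel. {x \<in> X. f x \<in> B} \<in> \<A>)"
proof -
  interpret sigma_algebra X \<A> by fact
  have "f -` B \<inter> X = {x \<in> X. f x \<in> B}" for B by auto
  then show ?thesis
    by (auto simp: meas_funs_def measurable_def sigma_sets_eq)
qed

lemma borel_measurable_restrict:
  assumes "f \<in> borel_measurable (sigma X \<A>)" "sigma_algebra X \<A>"
  shows "restrict f X \<in> borel_measurable (sigma X \<A>)"
proof -
  interpret sigma_algebra X \<A> by fact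
  show ?thesis
    using assms(1) by (subst measurable_cong[where g = f]) auto
qed

lemma meas_ring_cring:
  assumes "sigma_algebra X \<A>"
  shows "cring (meas_ring X \<A>)"
proof (intro cringI abelian_groupI comm_monoidI)
  fix f assume f: "f \<in> carrier (meas_ring X \<A>)"
  show "\<exists>g\<in>carrier (meas_ring X \<A>). g \<oplus>\<^bsub>meas_ring X \<A>\<^esub> f = \<zero>\<^bsub>meas_ring X \<A>\<^esub>"
  proof
    show "(\<lambda>x\<in>X. - f x) \<in> carrier (meas_ring X \<A>)"
      using f assms by (auto simp: meas_ring_def meas_funs_def intro!: borel_measurable_restrict)
    show "(\<lambda>x\<in>X. - f x) \<oplus>\<^bsub>meas_ring X \<A>\<^esub> f = \<zero>\<^bsub>meas_ring X \<A>\<^esub>"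
      by (auto simp: meas_ring_def fun_eq_iff)
  qed
next
  fix f assume "f \<in> carrier (meas_ring X \<A>)"
  then show "\<zero>\<^bsub>meas_ring X \<A>\<^esub> \<oplus>\<^bsub>meas_ring X \<A>\<^esub> f = f"
    "\<one>\<^bsub>meas_ring X \<A>\<^esub> \<otimes>\<^bsub>meas_ring X \<A>\<^esub> f = f"
    by (auto simp: meas_ring_def meas_funs_def fun_eq_iff extensional_def)
qed (use assms in \<open>auto simp: meas_ring_def meas_funs_def fun_eq_iff algebra_simps
       intro!: borel_measurable_restrict\<close>)

end

theory Submission
  imports Defs
begin

text \<open>If \<open>X\<close> is infinite, local finiteness yields a strictly increasing sequence
  \<open>B\<^sub>0 = {} \<subset> B\<^sub>1 \<subset> \<dots>\<close> of finite measurable sets. Let \<open>N\<close> be the index at which a point enters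
  the sequence, and \<open>0\<close> for points that never do. Then \<open>1 / N\<close> vanishes at infinity but has
  infinite support, and \<open>(1 / N) \<cdot> N\<close> is the indicator of an infinite set, so
  \<open>\<M>\<^sub>\<infinity>\<close> is not an ideal. If \<open>X\<close> is finite, everything collapses to \<open>\<M>\<close>.\<close>

text \<open>By local finiteness, the finite members of \<open>\<A>\<close> cover \<open>X\<close>;
  if there are only finitely many of them, their union is finite. This replaces (1) by finiteness of
  \<open>X\<close>, the dichotomy on which the rest turns.\<close>

lemma locally_finite_space_finite_iff:
  assumes "locally_finite_space X \<A>"
  shows "finite \<A> \<longleftrightarrow> finite X"
proof
  interpret sigma_algebra X \<A>
    using assms by (simp add: locally_finite_space_def measurable_space_def)
  show "finite \<A>" if "finite X"
    using that space_closed by (meson finite_Pow_iff finite_subset)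
  show "finite X" if "finite \<A>"
  proof (rule finite_subset)
    show "X \<subseteq> \<Union>{A \<in> \<A>. finite A}"
      using assms by (auto simp: locally_finite_space_def)
    show "finite (\<Union>{A \<in> \<A>. finite A})"
      using that by auto
  qed
qed

lemma infinite_locally_finite_space_chain:
  assumes lf: "locally_finite_space X \<A>" and inf: "infinite X"
  obtains B :: "nat \<Rightarrow> 'a set"
  where "B 0 = {}" "\<And>n. B n \<in> \<A>" "\<And>n. finite (B n)" "\<And>n. B n \<subset> B (Suc n)"
proof -
  interpret sigma_algebra X \<A>
    using lf by (simp add: locally_finite_space_def measurable_space_def)
  \<comment> \<open>The index enters \<open>P\<close> only to pin the start of the chain to
    \<open>{}\<close> in the dependent choice.\<close>
  define P where "P n C \<longleftrightarrow> C \<in> \<A> \<and> finite C \<and> (n = 0 \<longrightarrow> C = {})" for n :: nat and C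
  have "\<exists>D. P (Suc n) D \<and> C \<subset> D" if C: "P n C" for n C
  proof -
    \<comment> \<open>A finite \<open>C\<close> misses some point of the infinite \<open>X\<close>;
      adjoining a finite measurable set around that point enlarges \<open>C\<close>
      properly.\<close>
    obtain x where x: "x \<in> X" "x \<notin> C"
      using C inf by (metis P_def finite_subset subsetI)
    then obtain A where "A \<in> \<A>" "finite A" "x \<in> A"
      using lf by (auto simp: locally_finite_space_def)
    then show ?thesis
      using C x by (intro exI[of _ "A \<union> C"]) (auto simp: P_def)
  qed
  moreover have "P 0 {}"
    by (simp add: P_def)
  ultimately have "\<exists>B. \<forall>n. P n (B n) \<and> B n \<subset> B (Suc n)"
    by (intro dependent_nat_choice[of P "\<lambda>_ C D. C \<subset> D"]) auto
  then obtain B where "\<And>n. P n (B n)" "\<And>n. B n \<subset> B (Suc n)"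
    by metis
  then show ?thesis
    by (intro that[of B]) (auto simp: P_def)
qed

lemma infinite_locally_finite_space_index:
  assumes lf: "locally_finite_space X \<A>" and inf: "infinite X"
  obtains N :: "'a \<Rightarrow> nat"
  where "N \<in> measurable (sigma X \<A>) (count_space UNIV)"
    "infinite {x \<in> X. N x \<noteq> 0}" "\<And>n. finite {x \<in> X. N x \<noteq> 0 \<and> N x \<le> n}"
proof -
  interpret sigma_algebra X \<A>
    using lf by (simp add: locally_finite_space_def measurable_space_def)
  obtain B :: "nat \<Rightarrow> 'a set" where B0: "B 0 = {}" and BA: "\<And>n. B n \<in> \<A>"
    and fin: "\<And>n. finite (B n)" and step: "\<And>n. B n \<subset> B (Suc n)"
    by (rule infinite_locally_finite_space_chain[OF assms]) (rule that)
  define N where "N x = (if x \<in> (\<Union>n. B n) then LEAST n. x \<in> B n else 0)" for x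
  have mono: "B m \<subseteq> B n" if "m \<le> n" for m n
    using less_imp_le[OF step] that by (rule lift_Suc_mono_le)
  have BX: "B n \<subseteq> X" for n
    using BA sets_into_space by blast
  \<comment> \<open>Since \<open>B 0\<close> is empty, every point of the chain has index at least
    1, so the default 0 marks exactly the points outside all \<open>B n\<close>.\<close>
  have B_iff: "x \<in> B n \<longleftrightarrow> N x \<noteq> 0 \<and> N x \<le> n" for x n
  proof
    assume x: "x \<in> B n"
    then have "x \<in> B (N x)" "N x \<le> n"
      by (auto simp: N_def intro: LeastI Least_le)
    then show "N x \<noteq> 0 \<and> N x \<le> n"
      using B0 by (metis empty_iff)
  next
    assume N: "N x \<noteq> 0 \<and> N x \<le> n"
    then have "x \<in> (\<Union>n. B n)"
      by (auto simp: N_def split: if_splits)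
    then have "x \<in> B (N x)"
      by (auto simp: N_def intro: LeastI)
    then show "x \<in> B n"
      using N mono by blast
  qed
  \<comment> \<open>The codomain is countable, so measurability of \<open>N\<close> only needs its
    fibres: the complement of the union of the chain, and differences of consecutive
    members.\<close>
  have "N -` {n} \<inter> X \<in> \<A>" for n
  proof (cases n)
    case 0
    have "N -` {0} \<inter> X = X - (\<Union>n. B n)"
      using B_iff by auto
    then show ?thesis
      using 0 BA countable_UN[of B UNIV] by auto
  next
    case (Suc m)
    have "N -` {Suc m} \<inter> X = B (Suc m) - B m"
      using B_iff BX by (auto simp: set_eq_iff)
    then show ?thesis
      using Suc BA by auto
  qed
  then have "N \<in> measurable (sigma X \<A>) (count_space UNIV)"
    by (simp add: measurable_count_space_eq2_countable)
  moreover have "infinite {x \<in> X. N x \<noteq> 0}"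
  proof
    assume finN: "finite {x \<in> X. N x \<noteq> 0}"
    have "B n \<subseteq> {x \<in> X. N x \<noteq> 0}" for n
      using B_iff BX by auto
    then have "card (B n) \<le> card {x \<in> X. N x \<noteq> 0}" for n
      using finN card_mono by blast
    moreover have "strict_mono (\<lambda>n. card (B n))"
      using step fin by (simp add: strict_mono_Suc_iff psubset_card_mono)
    \<comment> \<open>Strict growth gives \<open>n \<le> card (B n)\<close>, which fails once
      \<open>n\<close> exceeds the alleged bound.\<close>
    ultimately show False
      by (meson Suc_n_not_le_n le_trans strict_mono_imp_increasing)
  qed
  moreover have "finite {x \<in> X. N x \<noteq> 0 \<and> N x \<le> n}" for n
    using fin[of n] by (rule finite_subset[rotated]) (auto simp: B_iff)
  ultimately show ?thesis
    by (rule that)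
qed

lemma infinite_locally_finite_space:
  assumes lf: "locally_finite_space X \<A>" and inf: "infinite X"
  shows "meas_F X \<A> \<noteq> meas_inf X \<A>" "\<not> ideal (meas_inf X \<A>) (meas_ring X \<A>)"
proof -
  have sa: "sigma_algebra X \<A>"
    using lf by (simp add: locally_finite_space_def measurable_space_def)
  obtain N :: "'a \<Rightarrow> nat" where [measurable]: "N \<in> measurable (sigma X \<A>) (count_space UNIV)"
    and N_inf: "infinite {x \<in> X. N x \<noteq> 0}"
    and N_fin: "\<And>n. finite {x \<in> X. N x \<noteq> 0 \<and> N x \<le> n}"
    by (rule infinite_locally_finite_space_index[OF assms]) (rule that)
  \<comment> \<open>Since \<open>1 / 0 = 0\<close>, \<open>f\<close> vanishes where \<open>N\<close> does.\<close>
  define f where "f = (\<lambda>x\<in>X. 1 / real (N x))"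
  define g where "g = (\<lambda>x\<in>X. real (N x))"
  have f: "f \<in> meas_funs X \<A>" and g: "g \<in> meas_funs X \<A>"
    unfolding f_def g_def meas_funs_def
    by (auto intro!: borel_measurable_restrict[OF _ sa])
  have "finite {x \<in> X. \<bar>f x\<bar> \<ge> \<epsilon>}" if "\<epsilon> > 0" for \<epsilon>
  proof (rule finite_subset[OF _ N_fin])
    \<comment> \<open>Where \<open>N x\<close> is positive, \<open>1 / N x \<ge> \<epsilon>\<close>
      means \<open>N x \<le> 1 / \<epsilon>\<close>, so only points of a single finite
      \<open>B n\<close> qualify.\<close>
    show "{x \<in> X. \<bar>f x\<bar> \<ge> \<epsilon>} \<subseteq> {x \<in> X. N x \<noteq> 0 \<and> N x \<le> nat \<lceil>1 / \<epsilon>\<rceil>}"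
    proof clarify
      fix x assume x: "x \<in> X" "\<bar>f x\<bar> \<ge> \<epsilon>"
      then have "\<epsilon> \<le> 1 / real (N x)"
        by (simp add: f_def)
      moreover from this have "N x \<noteq> 0"
        using that by (cases "N x = 0") auto
      ultimately have "real (N x) \<le> 1 / \<epsilon>"
        using that by (simp add: field_simps)
      then show "N x \<noteq> 0 \<and> N x \<le> nat \<lceil>1 / \<epsilon>\<rceil>"
        using \<open>N x \<noteq> 0\<close> by linarith
    qed
  qed
  then have f_inf: "f \<in> meas_inf X \<A>"
    using f by (simp add: meas_inf_def)
  have "{x \<in> X. f x \<noteq> 0} = {x \<in> X. N x \<noteq> 0}"
    by (auto simp: f_def)
  then have "f \<notin> meas_F X \<A>"
    using N_inf by (simp add: meas_F_def)
  then show "meas_F X \<A> \<noteq> meas_inf X \<A>"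
    using f_inf by auto
  show "\<not> ideal (meas_inf X \<A>) (meas_ring X \<A>)"
  proof
    assume "ideal (meas_inf X \<A>) (meas_ring X \<A>)"
    then have "f \<otimes>\<^bsub>meas_ring X \<A>\<^esub> g \<in> meas_inf X \<A>"
      using f_inf g by (intro ideal.I_r_closed) (auto simp: meas_ring_def)
    \<comment> \<open>The product takes only the values 0 and 1 on \<open>X\<close>, so the level 1
      already captures its whole support.\<close>
    then have "finite {x \<in> X. \<bar>(\<lambda>x\<in>X. f x * g x) x\<bar> \<ge> 1}"
      unfolding meas_inf_def meas_ring_def by (auto dest!: spec[of _ 1])
    moreover have "{x \<in> X. \<bar>(\<lambda>x\<in>X. f x * g x) x\<bar> \<ge> 1} = {x \<in> X. N x \<noteq> 0}"
      by (auto simp: f_def g_def)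
    ultimately show False
      using N_inf by simp
  qed
qed

lemma finite_measurable_space:
  assumes "finite X" and "sigma_algebra X \<A>"
  shows "meas_F X \<A> = meas_inf X \<A>" "ideal (meas_inf X \<A>) (meas_ring X \<A>)"
proof -
  have "meas_inf X \<A> = carrier (meas_ring X \<A>)"
    using \<open>finite X\<close> by (auto simp: meas_inf_def meas_ring_def)
  then show "ideal (meas_inf X \<A>) (meas_ring X \<A>)"
    using meas_ring_cring[OF assms(2)] by (simp add: cring_def ring.oneideal)
  show "meas_F X \<A> = meas_inf X \<A>"
    using \<open>finite X\<close> by (auto simp: meas_F_def meas_inf_def)
qed

theorem theorem4p7:
  fixes X :: "'a set" and \<A> :: "'a set set"
  assumes "locally_finite_space X \<A>"
  shows "(finite \<A> \<longleftrightarrow> meas_F X \<A> = meas_inf X \<A>) \<and>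
         (meas_F X \<A> = meas_inf X \<A> \<longleftrightarrow> ideal (meas_inf X \<A>) (meas_ring X \<A>))"
proof -
  have "sigma_algebra X \<A>"
    using assms by (simp add: locally_finite_space_def measurable_space_def)
  \<comment> \<open>All three statements hold when \<open>X\<close> is finite, and all three fail
    when it is infinite.\<close>
  then show ?thesis
    using locally_finite_space_finite_iff[OF assms] infinite_locally_finite_space[OF assms]
      finite_measurable_space by blast
qed

end
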